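(* For every $k\ge 3$ and $d,t\ge1$ there is a constant $C_1=C_1(k,d,t)$ such that, setting $M=R^{d,t}_{k-1}(n-1)$, we have $R^{d,t}_k(n)\le 2^{C_1 M\log M}$.
   Context: Let $P=\{p_1,\dots,p_N\}$ be an ordered set of points in $\mathbb{R}^d$ and let $\binom{P}{k}$ denote the set of $k$-tuples $(p_{i_1},\dots,p_{i_k})$ with $i_1<\dots<i_k$. A relation $E\subset\binom{P}{k}$ is semi-algebraic of complexity at most $t$ if there are polynomials $f_1,\dots,f_t\in\mathbb{R}[x_1,\dots,x_{dk}]$ of degree at most $t$ and a Boolean function $\Phi$ such that, with $E^*=\{x\in\mathbb{R}^{dk}:\Phi(f_1(x)\ge 0,\dots,f_t(x)\ge 0)=1\}$, we have $(p_{i_1},\dots,p_{i_k})\in E$ iff $(p_{i_1},\dots,p_{i_k})\in E^*$ for all $i_1<\dots<i_k$. A subset $S\subset P$ is homogeneous if $\binom{S}{k}\subset E$ or $\binom{S}{k}\cap E=\emptyset$; $\mathrm{hom}(P,E)$ is the largest size of a homogeneous subset. $R^{d,t}_k(n)$ is the minimum $N$ such that every ordered $N$-element point set $P\subset\mathbb{R}^d$ with every $k$-ary semi-algebraic relation $E\subset\binom{P}{k}$ of complexity at most $t$ satisfies $\mathrm{hom}(P,E)\ge n$.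
   Formalization: The formal theorem takes n ≥ 3: for n = 2 one has M = 1, so the bound reads 2 = R_k(2) ≤ 2^0 = 1, which is false for every C_1, and for n = 1 one has M = 0 and log M is undefined. *)

theory Defs
  imports "HOL-Analysis.Analysis" "HOL-Library.Poly_Mapping" "HOL-Library.Sublist"
    "HOL-Library.Ramsey"
begin

text \<open>
  A point of \<open>(\<real>\<^sup>d)\<^sup>k = \<real>\<^sup>d\<^sup>k\<close> is a list of \<open>k\<close> vectors of type \<^typ>\<open>real ^ 'd\<close>, with
  \<open>d = CARD('d)\<close>. Its \<open>dk\<close> coordinates, and hence the polynomial variables, are indexed by the
  pairs \<open>(j, i)\<close> with \<open>j < k\<close> and \<open>i :: 'd\<close>: variable \<open>(j, i)\<close> is coordinate \<open>i\<close> of the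
  \<open>j\<close>-th vector.
\<close>

type_synonym 'v monomial = "'v \<Rightarrow>\<^sub>0 nat"
type_synonym 'v real_mpoly = "'v monomial \<Rightarrow>\<^sub>0 real"

definition mpoly_eval :: "'v real_mpoly \<Rightarrow> ('v \<Rightarrow> real) \<Rightarrow> real" where
  "mpoly_eval f x =
     (\<Sum>m\<in>Poly_Mapping.keys f. Poly_Mapping.lookup f m *
        (\<Prod>v\<in>Poly_Mapping.keys m. x v ^ Poly_Mapping.lookup m v))"

definition mpoly_vars :: "'v real_mpoly \<Rightarrow> 'v set" where
  "mpoly_vars f = (\<Union>m\<in>Poly_Mapping.keys f. Poly_Mapping.keys m)"

definition monomial_degree :: "'v monomial \<Rightarrow> nat" where
  "monomial_degree m = (\<Sum>v\<in>Poly_Mapping.keys m. Poly_Mapping.lookup m v)"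

definition mpoly_degree_le :: "'v real_mpoly \<Rightarrow> nat \<Rightarrow> bool" where
  "mpoly_degree_le f t \<longleftrightarrow> (\<forall>m\<in>Poly_Mapping.keys f. monomial_degree m \<le> t)"

definition coords :: "(real ^ 'd) list \<Rightarrow> nat \<times> 'd \<Rightarrow> real" where
  "coords xs = (\<lambda>(j, i). (xs ! j) $ i)"

definition semialg_set ::
    "nat \<Rightarrow> (nat \<times> 'd) real_mpoly list \<Rightarrow> (bool list \<Rightarrow> bool) \<Rightarrow> (real ^ 'd) list set" where
  "semialg_set k fs \<Phi> =
     {xs. length xs = k \<and> \<Phi> (map (\<lambda>f. mpoly_eval f (coords xs) \<ge> 0) fs)}"

text \<open>
  An ordered point set \<open>p\<^sub>1, \<dots>, p\<^sub>N\<close> is a distinct list. For such a list \<open>P\<close>, the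
  \<open>k\<close>-tuples with increasing indices are the subsequences of length \<open>k\<close>, and the subsets of \<open>P\<close>
  (with the induced order) are the subsequences of \<open>P\<close>.
\<close>

definition ktuples :: "'a list \<Rightarrow> nat \<Rightarrow> 'a list set" where
  "ktuples P k = {xs. subseq xs P \<and> length xs = k}"

definition semialg_relation ::
    "nat \<Rightarrow> nat \<Rightarrow> (real ^ 'd) list \<Rightarrow> (real ^ 'd) list set \<Rightarrow> bool" where
  "semialg_relation k t P E \<longleftrightarrow>
     E \<subseteq> ktuples P k \<and>
     (\<exists>fs \<Phi>. length fs = t \<and>
        (\<forall>f\<in>set fs. mpoly_vars f \<subseteq> {..<k} \<times> UNIV \<and> mpoly_degree_le f t) \<and>
        (\<forall>xs\<in>ktuples P k. xs \<in> E \<longleftrightarrow> xs \<in> semialg_set k fs \<Phi>))"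

definition homogeneous :: "nat \<Rightarrow> 'a list set \<Rightarrow> 'a list \<Rightarrow> bool" where
  "homogeneous k E S \<longleftrightarrow> ktuples S k \<subseteq> E \<or> ktuples S k \<inter> E = {}"

definition hom_number :: "nat \<Rightarrow> 'a list \<Rightarrow> 'a list set \<Rightarrow> nat" where
  "hom_number k P E = Max {length S | S. subseq S P \<and> homogeneous k E S}"

definition semialg_ramsey_property :: "'d::finite itself \<Rightarrow> nat \<Rightarrow> nat \<Rightarrow> nat \<Rightarrow> nat \<Rightarrow> bool" where
  "semialg_ramsey_property D k t n N \<longleftrightarrow>
     (\<forall>P :: (real ^ 'd) list. distinct P \<and> length P = N \<longrightarrow>
        (\<forall>E. semialg_relation k t P E \<longrightarrow> hom_number k P E \<ge> n))"

definition semialg_ramsey :: "'d::finite itself \<Rightarrow> nat \<Rightarrow> nat \<Rightarrow> nat \<Rightarrow> nat" where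
  "semialg_ramsey D k t n = (LEAST N. semialg_ramsey_property D k t n N)"

lemma finite_homogeneous_lengths:
  "finite {length S | S. subseq S P \<and> homogeneous k E S}"
  by (rule finite_subset[of _ "length ` set (subseqs P)"]) auto

lemma subseq_set_subset: "subseq xs ys \<Longrightarrow> set xs \<subseteq> set ys"
  by (auto simp: subseq_conv_nths dest: in_set_nthsD)

lemma subseq_distinct_eq_filter:
  "subseq xs P \<Longrightarrow> distinct P \<Longrightarrow> xs = filter (\<lambda>p. p \<in> set xs) P"
proof (induction rule: list_emb.induct)
  case (list_emb_Nil ys)
  then show ?case by simp
next
  case (list_emb_Cons xs ys y)
  then have "y \<notin> set xs"
    by (auto dest: subseq_set_subset)
  with list_emb_Cons show ?case by simp
next
  case (list_emb_Cons2 x y xs ys)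
  then have "filter (\<lambda>p. p = x \<or> p \<in> set xs) ys = filter (\<lambda>p. p \<in> set xs) ys"
    by (intro filter_cong) auto
  with list_emb_Cons2 show ?case by simp
qed

text \<open>By Ramsey's theorem the minimum defining \<^const>\<open>semialg_ramsey\<close> is attained.\<close>

lemma semialg_ramsey_property_ex:
  "\<exists>N. semialg_ramsey_property TYPE('d::finite) k t n N"
proof -
  obtain N :: nat where N: "partn_lst {..<N} [n, n] k"
    using ramsey_full by blast
  have "hom_number k P E \<ge> n"
    if P: "distinct P" "length P = N" for P :: "(real ^ 'd) list" and E
  proof -
    define c where "c = (\<lambda>X. if filter (\<lambda>p. p \<in> (!) P ` X) P \<in> E then 0 else (1::nat))"
    have "c \<in> nsets {..<N} k \<rightarrow> {..<length [n, n]}"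
      by (auto simp: c_def)
    then obtain i where i: "i < length [n, n]" "monochromatic {..<N} ([n, n] ! i) k c i"
      using N unfolding partn_lst_def by blast
    then have "[n, n] ! i = n"
      by (auto simp: less_Suc_eq)
    with i obtain H where H: "H \<in> nsets {..<N} n" "c ` nsets H k \<subseteq> {i}"
      unfolding monochromatic_def by auto
    define S where "S = filter (\<lambda>p. p \<in> (!) P ` H) P"
    have sub: "H \<subseteq> {..<length P}" "card H = n"
      using H P by (auto simp: nsets_def)
    have inj: "inj_on ((!) P) {..<length P}"
      using P by (auto simp: inj_on_def nth_eq_iff_index_eq)
    have setS: "set S = (!) P ` H"
      using sub by (auto simp: S_def)
    have "length S = card (set S)"
      using P(1) by (metis S_def distinct_card distinct_filter)
    also have "\<dots> = n"
      unfolding setS using sub inj by (metis card_image inj_on_subset)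
    finally have len: "length S = n" .
    have *: "xs \<in> E \<longleftrightarrow> i = 0" if xs: "xs \<in> ktuples S k" for xs
    proof -
      define X where "X = {j \<in> H. P ! j \<in> set xs}"
      have ssS: "subseq xs S" "length xs = k"
        using xs by (auto simp: ktuples_def)
      then have ss: "subseq xs P"
        unfolding S_def using subseq_filter_left subseq_order.order_trans by blast
      have "set xs \<subseteq> (!) P ` H"
        using subseq_set_subset[OF ssS(1)] setS by auto
      then have img: "(!) P ` X = set xs"
        by (auto simp: X_def)
      have "distinct xs"
        using subseq_distinct_eq_filter[OF ss P(1)] P(1) by (metis distinct_filter)
      moreover have "X \<subseteq> {..<length P}"
        using sub by (auto simp: X_def)
      ultimately have "card X = k"
        using img inj ssS(2) by (metis card_image distinct_card inj_on_subset)
      then have "X \<in> nsets H k"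
        using sub by (auto simp: nsets_def X_def intro: finite_subset)
      then have "c X = i"
        using H by auto
      then show ?thesis
        using subseq_distinct_eq_filter[OF ss P(1)] img by (auto simp: c_def split: if_splits)
    qed
    have "homogeneous k E S"
      unfolding homogeneous_def using * by (cases "i = 0") auto
    moreover have "subseq S P"
      by (simp add: S_def)
    ultimately show ?thesis
      unfolding hom_number_def using len
      by (intro Max_ge finite_homogeneous_lengths) auto
  qed
  then show ?thesis
    unfolding semialg_ramsey_property_def by blast
qed

end

theory Submission
  imports Defs
begin

text \<open>
  Greedy argument of Erdos and Rado: pick points one after another and, after each choice, keep
  only the remaining points with the same trace, where the trace of \<open>p\<close> is the set of
  \<open>(k-1)\<close>-tuples \<open>xs\<close> of chosen points with \<open>xs @ [p] \<in> E\<close>. With \<open>M\<close> chosen points there are only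
  \<open>M\<^sup>O\<^sup>(\<^sup>1\<^sup>)\<close> traces, so \<open>M\<^sup>O\<^sup>(\<^sup>M\<^sup>)\<close> initial points suffice to choose \<open>M\<close> of them and one
  further point \<open>s\<close>. Among them, membership of a \<open>k\<close>-tuple in \<open>E\<close> does not depend on its last
  entry, which may therefore be replaced by \<open>s\<close>; substituting \<open>s\<close> into the polynomials gives a
  \<open>(k-1)\<close>-ary relation of the same complexity on the \<open>M\<close> points.

  The bound on the number of traces replaces the Milnor-Thom theorem by the Sauer-Shelah lemma:
  polynomials of bounded degree in one point form a space of bounded dimension, and this
  dimension bounds the VC dimension of the sign patterns.
\<close>

section \<open>Linear relations among more vectors than coordinates\<close>

text \<open>Gaussian elimination by induction on the coordinates. If some vector has a nonzero entry
  at \<open>b\<close>, it serves as pivot \<open>j\<close> and clears that entry from all others;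
  one coordinate and one vector drop out, so the strict inequality persists.\<close>

lemma nontrivial_kernel:
  fixes a :: "'i \<Rightarrow> 'b \<Rightarrow> 'c::field"
  assumes "finite B" and "finite J" and "card B < card J"
  shows "\<exists>c. (\<exists>i\<in>J. c i \<noteq> 0) \<and> (\<forall>b\<in>B. (\<Sum>i\<in>J. c i * a i b) = 0)"
  using assms
proof (induction B arbitrary: J a rule: finite_induct)
  case empty
  then have "J \<noteq> {}" by auto
  then show ?case by (auto intro!: exI[of _ "\<lambda>_. 1"])
next
  case (insert b B)
  show ?case
  proof (cases "\<forall>i\<in>J. a i b = 0")
    case True
    with insert.IH[of J a] insert.prems insert.hyps show ?thesis by auto
  next
    case False
    then obtain j where j: "j \<in> J" "a j b \<noteq> 0" by auto
    define a' where "a' i x = a i x - a i b / a j b * a j x" for i x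
    have "card B < card (J - {j})"
      using insert.prems insert.hyps j by simp
    with insert.IH[of "J - {j}" a'] insert.prems obtain c where
      c: "\<exists>i\<in>J - {j}. c i \<noteq> 0" "\<And>x. x \<in> B \<Longrightarrow> (\<Sum>i\<in>J - {j}. c i * a' i x) = 0"
      by auto
    \<comment> \<open>The coefficient of \<open>j\<close> collects the multiples of the pivot that
      were subtracted, so the combination of the original vectors equals that of the reduced
      ones.\<close>
    define c' where "c' = c(j := - (\<Sum>i\<in>J - {j}. c i * a i b) / a j b)"
    have c'sum: "(\<Sum>i\<in>J. c' i * a i x) = (\<Sum>i\<in>J - {j}. c i * a' i x)" for x
    proof -
      have "(\<Sum>i\<in>J. c' i * a i x) = c' j * a j x + (\<Sum>i\<in>J - {j}. c i * a i x)"
        using insert.prems j by (subst sum.remove[of _ j]) (auto simp: c'_def)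
      also have "c' j * a j x = - (\<Sum>i\<in>J - {j}. c i * (a i b / a j b * a j x))"
      proof -
        have "c' j * a j x = - (\<Sum>i\<in>J - {j}. c i * a i b) * (a j x / a j b)"
          by (simp add: c'_def)
        also have "\<dots> = - (\<Sum>i\<in>J - {j}. c i * a i b * (a j x / a j b))"
          by (simp only: sum_distrib_right mult_minus_left)
        finally show ?thesis by (simp add: mult_ac)
      qed
      finally show ?thesis
        by (simp add: a'_def right_diff_distrib sum_subtractf)
    qed
    have "a' i b = 0" for i
      using j by (simp add: a'_def)
    then have "\<forall>x\<in>insert b B. (\<Sum>i\<in>J. c' i * a i x) = 0"
      using c'sum c(2) by auto
    moreover have "\<exists>i\<in>J. c' i \<noteq> 0"
      using c(1) by (auto simp: c'_def)
    ultimately show ?thesis by blast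
  qed
qed

section \<open>Shattering, the Sauer-Shelah lemma and sign patterns\<close>

definition shatters :: "'a set set \<Rightarrow> 'a set \<Rightarrow> bool" where
  "shatters F S \<longleftrightarrow> (\<forall>T\<subseteq>S. \<exists>A\<in>F. A \<inter> S = T)"

text \<open>Pajor's form of the lemma, by induction on \<open>X\<close>. \<open>F0\<close> is the
  trace of \<open>F\<close> on \<open>X\<close>, and \<open>F1\<close> consists of the traces that
  arise twice. What \<open>F0\<close> shatters, \<open>F\<close> shatters; what \<open>F1\<close>
  shatters, \<open>F\<close> shatters even with \<open>x\<close> added. The element \<open>x\<close>
  tells the two kinds of sets apart.\<close>

lemma card_le_card_shattered:
  assumes "finite X" and "F \<subseteq> Pow X"
  shows "card F \<le> card {S. S \<subseteq> X \<and> shatters F S}"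
  using assms
proof (induction X arbitrary: F rule: finite_induct)
  case empty
  then have "F = {} \<or> F = {{}}" by auto
  then show ?case
  proof
    assume F: "F = {{}}"
    then have "{S. S \<subseteq> {} \<and> shatters F S} = {{}}"
      by (auto simp: shatters_def)
    with F show ?thesis by (simp only: order.refl)
  qed simp
next
  case (insert x X)
  define F0 where "F0 = (\<lambda>A. A - {x}) ` F"
  define F1 where "F1 = {A \<in> F. x \<notin> A \<and> insert x A \<in> F}"
  have fin: "finite F"
    using insert.prems insert.hyps(1) by (auto intro: finite_subset[of F "Pow (insert x X)"])
  \<comment> \<open>Deleting \<open>x\<close> is injective on \<open>Fx\<close>. The resulting
    family and \<open>Fn\<close> have union \<open>F0\<close> and intersection \<open>F1\<close>, so
    inclusion-exclusion counts \<open>F\<close>.\<close>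
  define Fx where "Fx = {A \<in> F. x \<in> A}"
  define Fn where "Fn = {A \<in> F. x \<notin> A}"
  have "card F = card Fx + card Fn"
  proof -
    have "F = Fx \<union> Fn" "Fx \<inter> Fn = {}"
      by (auto simp: Fx_def Fn_def)
    moreover from this have "finite Fx" "finite Fn"
      using fin by auto
    ultimately show ?thesis
      using card_Un_disjoint[of Fx Fn] by simp
  qed
  moreover have "card Fx = card ((\<lambda>A. A - {x}) ` Fx)"
    by (rule card_image[symmetric]) (auto simp: inj_on_def Fx_def)
  moreover have "F0 = ((\<lambda>A. A - {x}) ` Fx) \<union> Fn"
  proof -
    have "(\<lambda>A. A - {x}) ` Fn = id ` Fn"
      by (rule image_cong) (auto simp: Fn_def)
    moreover have "F = Fx \<union> Fn"
      by (auto simp: Fx_def Fn_def)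
    then have "F0 = (\<lambda>A. A - {x}) ` Fx \<union> (\<lambda>A. A - {x}) ` Fn"
      by (simp only: F0_def image_Un)
    ultimately show ?thesis by simp
  qed
  moreover have "F1 = ((\<lambda>A. A - {x}) ` Fx) \<inter> Fn"
  proof (intro equalityI subsetI)
    fix A assume "A \<in> F1"
    then have "insert x A \<in> Fx" "A \<in> Fn" "A = insert x A - {x}"
      by (auto simp: F1_def Fx_def Fn_def)
    then show "A \<in> ((\<lambda>A. A - {x}) ` Fx) \<inter> Fn" by blast
  next
    fix A assume "A \<in> ((\<lambda>A. A - {x}) ` Fx) \<inter> Fn"
    then obtain A' where "A' \<in> F" "x \<in> A'" "A = A' - {x}" "A \<in> F"
      by (auto simp: Fx_def Fn_def)
    then show "A \<in> F1" by (simp add: F1_def insert_absorb)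
  qed
  moreover have "finite Fx" "finite Fn"
    using fin by (auto simp: Fx_def Fn_def)
  ultimately have cF: "card F = card F0 + card F1"
    using card_Un_Int[of "(\<lambda>A. A - {x}) ` Fx" Fn] by auto
  let ?G = "\<lambda>F. {S. S \<subseteq> X \<and> shatters F S}"
  have "F0 \<subseteq> Pow X" "F1 \<subseteq> Pow X"
    using insert.prems by (auto simp: F0_def F1_def)
  then have "card F \<le> card (?G F0) + card (?G F1)"
    using insert.IH[of F0] insert.IH[of F1] cF by linarith
  also have "card (?G F1) = card (insert x ` ?G F1)"
    using insert.hyps by (intro card_image[symmetric]) (auto simp: inj_on_def)
  also have "card (?G F0) + card (insert x ` ?G F1) = card (?G F0 \<union> insert x ` ?G F1)"
    using insert.hyps by (intro card_Un_disjoint[symmetric]) auto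
  also have "\<dots> \<le> card {S. S \<subseteq> insert x X \<and> shatters F S}"
  proof (rule card_mono)
    show "finite {S. S \<subseteq> insert x X \<and> shatters F S}"
      using insert.hyps by simp
    have "shatters F S" if "S \<subseteq> X" "shatters F0 S" for S
      unfolding shatters_def
    proof (intro allI impI)
      fix T assume "T \<subseteq> S"
      with that(2) obtain A' where "A' \<in> F0" "A' \<inter> S = T"
        unfolding shatters_def by blast
      then obtain A where "A \<in> F" "(A - {x}) \<inter> S = T"
        unfolding F0_def by blast
      moreover from this have "A \<inter> S = T"
        using that(1) insert.hyps by blast
      ultimately show "\<exists>A\<in>F. A \<inter> S = T" by blast
    qed
    moreover have "shatters F (insert x S)" if "S \<subseteq> X" "shatters F1 S" for S
      unfolding shatters_def
    proof (intro allI impI)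
      fix T assume T: "T \<subseteq> insert x S"
      then have "T - {x} \<subseteq> S" by auto
      with that(2) obtain A where A: "A \<in> F1" "A \<inter> S = T - {x}"
        unfolding shatters_def by blast
      \<comment> \<open>Both \<open>A\<close> and \<open>insert x A\<close> belong to
        \<open>F\<close>; whether \<open>x\<close> lies in \<open>T\<close> decides which one to
        take.\<close>
      show "\<exists>A\<in>F. A \<inter> insert x S = T"
      proof (cases "x \<in> T")
        case True
        then have "insert x A \<inter> insert x S = T" using A by blast
        moreover have "insert x A \<in> F" using A(1) by (simp add: F1_def)
        ultimately show ?thesis by blast
      next
        case False
        moreover have "x \<notin> A" "A \<in> F" using A(1) by (simp_all add: F1_def)
        ultimately have "A \<inter> insert x S = T" using A(2) by blast
        with \<open>A \<in> F\<close> show ?thesis by blast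
      qed
    qed
    ultimately show "?G F0 \<union> insert x ` ?G F1 \<subseteq> {S. S \<subseteq> insert x X \<and> shatters F S}"
      by blast
  qed
  finally show ?case .
qed

text \<open>Padding with \<open>None\<close> encodes every small subset as a list of length exactly
  \<open>D\<close> over an alphabet of \<open>card X + 1\<close> letters.\<close>

lemma card_small_subsets_le:
  assumes "finite X"
  shows "card {S. S \<subseteq> X \<and> card S \<le> D} \<le> (card X + 1) ^ D"
proof -
  let ?L = "{l. set l \<subseteq> insert None (Some ` X) \<and> length l = D}"
  have "{S. S \<subseteq> X \<and> card S \<le> D} \<subseteq> (\<lambda>l. {x. Some x \<in> set l}) ` ?L"
  proof
    fix S assume "S \<in> {S. S \<subseteq> X \<and> card S \<le> D}"
    then have S: "S \<subseteq> X" "card S \<le> D" by auto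
    then obtain l where l: "set l = S" "distinct l"
      using assms finite_distinct_list finite_subset by metis
    define l' where "l' = map Some l @ replicate (D - length l) None"
    have "length l' = D"
      using l S distinct_card[of l] by (simp add: l'_def)
    moreover have "set l' \<subseteq> insert None (Some ` X)" "{x. Some x \<in> set l'} = S"
      using l S by (auto simp: l'_def)
    ultimately show "S \<in> (\<lambda>l. {x. Some x \<in> set l}) ` ?L" by blast
  qed
  then have "card {S. S \<subseteq> X \<and> card S \<le> D} \<le> card ?L"
    using assms by (intro surj_card_le finite_lists_length_eq) auto
  also have "\<dots> = (card X + 1) ^ D"
    using assms by (simp add: card_lists_length_eq card_image)
  finally show ?thesis .
qed

lemma sauer_shelah:
  assumes "finite X" and "F \<subseteq> Pow X"
    and "\<And>S. S \<subseteq> X \<Longrightarrow> shatters F S \<Longrightarrow> card S \<le> D"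
  shows "card F \<le> (card X + 1) ^ D"
proof -
  have "card F \<le> card {S. S \<subseteq> X \<and> shatters F S}"
    using assms(1,2) by (rule card_le_card_shattered)
  also have "\<dots> \<le> card {S. S \<subseteq> X \<and> card S \<le> D}"
    using assms by (intro card_mono) auto
  also have "\<dots> \<le> (card X + 1) ^ D"
    using assms(1) by (rule card_small_subsets_le)
  finally show ?thesis .
qed

text \<open>
  A shattered index set larger than the dimension would carry a linear relation whose negative
  coefficients sit exactly where the functions are negative, which is impossible.
\<close>

lemma card_sign_patterns_le:
  fixes g :: "'i \<Rightarrow> 'x \<Rightarrow> real"
  assumes "finite I" and "finite B"
    and g: "\<And>i x. i \<in> I \<Longrightarrow> g i x = (\<Sum>b\<in>B. a i b * e b x)"
  shows "card (range (\<lambda>x. {i \<in> I. g i x \<ge> 0})) \<le> (card I + 1) ^ card B"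
proof (rule sauer_shelah)
  fix J assume J: "J \<subseteq> I" and sh: "shatters (range (\<lambda>x. {i \<in> I. g i x \<ge> 0})) J"
  show "card J \<le> card B"
  proof (rule ccontr)
    assume "\<not> card J \<le> card B"
    moreover have "finite J" using J assms(1) finite_subset by blast
    ultimately obtain c where c: "\<exists>i\<in>J. c i \<noteq> 0" "\<And>b. b \<in> B \<Longrightarrow> (\<Sum>i\<in>J. c i * a i b) = 0"
      using nontrivial_kernel[of B J a] assms(2) by auto
    have rel: "(\<Sum>i\<in>J. c i * g i x) = 0" for x
    proof -
      have "(\<Sum>i\<in>J. c i * g i x) = (\<Sum>i\<in>J. \<Sum>b\<in>B. c i * a i b * e b x)"
        using J by (intro sum.cong) (auto simp: g sum_distrib_left mult_ac)
      also have "\<dots> = (\<Sum>b\<in>B. (\<Sum>i\<in>J. c i * a i b) * e b x)"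
        by (subst sum.swap) (simp add: sum_distrib_right)
      finally show ?thesis using c(2) by simp
    qed
    \<comment> \<open>Only a negative coefficient forces a strict sign of \<open>g i x\<close>,
      since a nonnegative one leaves the value 0 possible. The factor \<open>s\<close> flips the
      relation if it has no negative coefficient.\<close>
    obtain s where s: "s = 1 \<or> s = (-1::real)" "\<exists>i\<in>J. s * c i < 0"
    proof -
      from c(1) obtain i where "i \<in> J" "c i \<noteq> 0" by blast
      then show ?thesis
        using that[of 1] that[of "-1"] by (cases "c i < 0") force+
    qed
    have "{i \<in> J. s * c i \<ge> 0} \<subseteq> J" by auto
    with sh obtain x where x: "{i \<in> I. g i x \<ge> 0} \<inter> J = {i \<in> J. s * c i \<ge> 0}"
      unfolding shatters_def by force
    have sgn: "g i x \<ge> 0 \<longleftrightarrow> s * c i \<ge> 0" if "i \<in> J" for i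
      using x J that by blast
    from s(2) obtain i where i: "i \<in> J" "s * c i < 0" by blast
    have "(\<Sum>i\<in>J. s * c i * g i x) > 0"
    proof (rule sum_pos2)
      show "i \<in> J" by fact
      show "0 < s * c i * g i x"
        using i(2) sgn[OF i(1)] by (intro mult_neg_neg) auto
      show "0 \<le> s * c j * g j x" if "j \<in> J" for j
        using sgn[OF that] by (cases "s * c j \<ge> 0") (simp_all add: mult_nonpos_nonpos)
    qed (use \<open>finite J\<close> in auto)
    also have "(\<Sum>i\<in>J. s * c i * g i x) = s * (\<Sum>i\<in>J. c i * g i x)"
      by (simp add: sum_distrib_left mult_ac)
    finally show False using rel by simp
  qed
qed (use assms in auto)

section \<open>Evaluating polynomials and splitting off the last point\<close>

text \<open>Terms may cancel in \<open>f + g\<close>, so additivity of evaluation needs sums over a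
  common key set.\<close>

lemma mpoly_eval_superset:
  assumes "finite K" and "Poly_Mapping.keys f \<subseteq> K"
  shows "mpoly_eval f x =
    (\<Sum>m\<in>K. Poly_Mapping.lookup f m * (\<Prod>v\<in>Poly_Mapping.keys m. x v ^ Poly_Mapping.lookup m v))"
  unfolding mpoly_eval_def using assms
  by (intro sum.mono_neutral_left) (auto simp: in_keys_iff)

lemma mpoly_eval_add: "mpoly_eval (f + g) x = mpoly_eval f x + mpoly_eval g x"
proof -
  let ?K = "Poly_Mapping.keys f \<union> Poly_Mapping.keys g"
  have "Poly_Mapping.keys (f + g) \<subseteq> ?K" by (rule keys_add)
  then show ?thesis
    using mpoly_eval_superset[of ?K "f + g" x] mpoly_eval_superset[of ?K f x]
      mpoly_eval_superset[of ?K g x]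
    by (simp add: lookup_add distrib_right sum.distrib)
qed

lemma mpoly_eval_sum: "finite A \<Longrightarrow> mpoly_eval (sum f A) x = (\<Sum>a\<in>A. mpoly_eval (f a) x)"
  by (induction A rule: finite_induct) (simp_all add: mpoly_eval_add, simp add: mpoly_eval_def)

lemma mpoly_eval_single:
  "mpoly_eval (Poly_Mapping.single m c) x =
     c * (\<Prod>v\<in>Poly_Mapping.keys m. x v ^ Poly_Mapping.lookup m v)"
  using mpoly_eval_superset[of "{m}" "Poly_Mapping.single m c" x] by simp

text \<open>Monomials are exponent maps, so this sum stands for a product of powers: the factor of
  \<open>m\<close> that belongs to the points before position \<open>l\<close>.\<close>

definition init_monomial :: "nat \<Rightarrow> (nat \<times> 'd) monomial \<Rightarrow> (nat \<times> 'd) monomial" where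
  "init_monomial l m =
     (\<Sum>v\<in>{v \<in> Poly_Mapping.keys m. fst v < l}. Poly_Mapping.single v (Poly_Mapping.lookup m v))"

lemma lookup_init_monomial:
  "Poly_Mapping.lookup (init_monomial l m) v = (if fst v < l then Poly_Mapping.lookup m v else 0)"
proof -
  have "Poly_Mapping.lookup (init_monomial l m) v =
      (\<Sum>w\<in>{w \<in> Poly_Mapping.keys m. fst w < l}. if w = v then Poly_Mapping.lookup m w else 0)"
    by (simp add: init_monomial_def lookup_sum lookup_single when_def)
  also have "\<dots> = (if fst v < l then Poly_Mapping.lookup m v else 0)"
    by (simp add: sum.delta in_keys_iff)
  finally show ?thesis .
qed

lemma keys_init_monomial:
  "Poly_Mapping.keys (init_monomial l m) = {v \<in> Poly_Mapping.keys m. fst v < l}"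
  by (auto simp: in_keys_iff lookup_init_monomial split: if_splits)

lemma monomial_degree_init_le: "monomial_degree (init_monomial l m) \<le> monomial_degree m"
  unfolding monomial_degree_def keys_init_monomial
  by (intro order.trans[OF sum_mono sum_mono2]) (auto simp: lookup_init_monomial)

lemma lookup_le_monomial_degree: "Poly_Mapping.lookup m v \<le> monomial_degree m"
proof (cases "v \<in> Poly_Mapping.keys m")
  case True
  then show ?thesis
    unfolding monomial_degree_def by (intro member_le_sum) auto
qed (simp add: in_keys_iff)

lemma monomial_eval_snoc:
  fixes m :: "(nat \<times> 'd::finite) monomial"
  assumes "Poly_Mapping.keys m \<subseteq> {..<Suc l} \<times> UNIV" and "length xs = l"
  shows "(\<Prod>v\<in>Poly_Mapping.keys m. coords (xs @ [p]) v ^ Poly_Mapping.lookup m v) =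
    (\<Prod>v\<in>Poly_Mapping.keys (init_monomial l m).
       coords xs v ^ Poly_Mapping.lookup (init_monomial l m) v) *
    (\<Prod>i\<in>UNIV. p $ i ^ Poly_Mapping.lookup m (l, i))"
proof -
  let ?g = "\<lambda>v. coords (xs @ [p]) v ^ Poly_Mapping.lookup m v"
  have "(\<Prod>v\<in>Poly_Mapping.keys m. ?g v) =
      (\<Prod>v\<in>Poly_Mapping.keys (init_monomial l m) \<union> Pair l ` UNIV. ?g v)"
  proof (rule prod.mono_neutral_left)
    show "Poly_Mapping.keys m \<subseteq> Poly_Mapping.keys (init_monomial l m) \<union> Pair l ` UNIV"
    proof
      fix v assume v: "v \<in> Poly_Mapping.keys m"
      with assms(1) have "fst v < Suc l" by auto
      with v show "v \<in> Poly_Mapping.keys (init_monomial l m) \<union> Pair l ` UNIV"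
        by (cases v) (simp add: keys_init_monomial less_Suc_eq image_iff)
    qed
  qed (auto simp: keys_init_monomial in_keys_iff)
  also have "\<dots> = (\<Prod>v\<in>Poly_Mapping.keys (init_monomial l m). ?g v) * (\<Prod>v\<in>Pair l ` UNIV. ?g v)"
    by (rule prod.union_disjoint) (auto simp: keys_init_monomial)
  also have "(\<Prod>v\<in>Pair l ` UNIV. ?g v) = (\<Prod>i\<in>UNIV. p $ i ^ Poly_Mapping.lookup m (l, i))"
    using assms(2) by (subst prod.reindex) (auto simp: inj_on_def coords_def)
  also have "(\<Prod>v\<in>Poly_Mapping.keys (init_monomial l m). ?g v) =
      (\<Prod>v\<in>Poly_Mapping.keys (init_monomial l m).
       coords xs v ^ Poly_Mapping.lookup (init_monomial l m) v)"
    using assms(2)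
    by (intro prod.cong) (auto simp: keys_init_monomial lookup_init_monomial coords_def nth_append)
  finally show ?thesis .
qed

lemma mpoly_eval_snoc:
  fixes f :: "(nat \<times> 'd::finite) real_mpoly"
  assumes "mpoly_vars f \<subseteq> {..<Suc l} \<times> UNIV" and "length xs = l"
  shows "mpoly_eval f (coords (xs @ [p])) =
    (\<Sum>m\<in>Poly_Mapping.keys f. Poly_Mapping.lookup f m *
      (\<Prod>v\<in>Poly_Mapping.keys (init_monomial l m).
         coords xs v ^ Poly_Mapping.lookup (init_monomial l m) v) *
      (\<Prod>i\<in>UNIV. p $ i ^ Poly_Mapping.lookup m (l, i)))"
  unfolding mpoly_eval_def
proof (rule sum.cong[OF refl])
  fix m assume "m \<in> Poly_Mapping.keys f"
  then have "Poly_Mapping.keys m \<subseteq> {..<Suc l} \<times> UNIV"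
    using assms(1) by (auto simp: mpoly_vars_def)
  then show "Poly_Mapping.lookup f m *
      (\<Prod>v\<in>Poly_Mapping.keys m. coords (xs @ [p]) v ^ Poly_Mapping.lookup m v) =
      Poly_Mapping.lookup f m *
      (\<Prod>v\<in>Poly_Mapping.keys (init_monomial l m).
         coords xs v ^ Poly_Mapping.lookup (init_monomial l m) v) *
      (\<Prod>i\<in>UNIV. p $ i ^ Poly_Mapping.lookup m (l, i))"
    by (simp only: monomial_eval_snoc[OF _ assms(2)] mult.assoc)
qed

text \<open>With \<open>p\<close> fixed, its powers move into the coefficients, which cannot raise
  the degree. Monomials with the same initial factor merge and may cancel, so the keys of
  \<open>f'\<close> are only bounded by an inclusion.\<close>

lemma mpoly_substitute_last:
  fixes f :: "(nat \<times> 'd::finite) real_mpoly"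
  assumes "mpoly_vars f \<subseteq> {..<Suc l} \<times> UNIV" and "mpoly_degree_le f t"
  obtains f' where "mpoly_vars f' \<subseteq> {..<l} \<times> UNIV" and "mpoly_degree_le f' t"
    and "\<And>xs. length xs = l \<Longrightarrow> mpoly_eval f' (coords xs) = mpoly_eval f (coords (xs @ [p]))"
proof -
  define f' where "f' = (\<Sum>m\<in>Poly_Mapping.keys f. Poly_Mapping.single (init_monomial l m)
    (Poly_Mapping.lookup f m * (\<Prod>i\<in>UNIV. p $ i ^ Poly_Mapping.lookup m (l, i))))"
  have keys: "Poly_Mapping.keys f' \<subseteq> init_monomial l ` Poly_Mapping.keys f"
    unfolding f'_def by (rule order.trans[OF keys_sum]) auto
  show ?thesis
  proof
    show "mpoly_vars f' \<subseteq> {..<l} \<times> UNIV"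
      unfolding mpoly_vars_def
    proof (rule UN_least)
      fix m assume "m \<in> Poly_Mapping.keys f'"
      with keys obtain m' where "m = init_monomial l m'" by blast
      then show "Poly_Mapping.keys m \<subseteq> {..<l} \<times> UNIV"
        by (auto simp: keys_init_monomial)
    qed
    show "mpoly_degree_le f' t"
      unfolding mpoly_degree_le_def
    proof
      fix m assume "m \<in> Poly_Mapping.keys f'"
      with keys obtain m' where "m' \<in> Poly_Mapping.keys f" "m = init_monomial l m'" by blast
      then show "monomial_degree m \<le> t"
        using assms(2) monomial_degree_init_le[of l m'] unfolding mpoly_degree_le_def
        by (auto intro: order.trans)
    qed
    show "mpoly_eval f' (coords xs) = mpoly_eval f (coords (xs @ [p]))" if "length xs = l" for xs
      unfolding f'_def mpoly_eval_snoc[OF assms(1) that]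
      by (simp add: mpoly_eval_sum mpoly_eval_single mult_ac)
  qed
qed

text \<open>Here \<open>p\<close> varies instead: each polynomial is a linear combination of the
  same \<open>(t + 1) ^ CARD('d)\<close> monomials in \<open>p\<close>, with coefficients depending
  only on \<open>f\<close> and \<open>xs\<close>. This supplies the dimension for the sign pattern
  bound.\<close>

lemma mpoly_eval_snoc_expand:
  fixes f :: "(nat \<times> 'd::finite) real_mpoly"
  assumes "mpoly_vars f \<subseteq> {..<Suc l} \<times> UNIV" and "mpoly_degree_le f t" and "length xs = l"
  shows "mpoly_eval f (coords (xs @ [p])) =
    (\<Sum>b\<in>UNIV \<rightarrow>\<^sub>E {..t}.
      (\<Sum>m\<in>{m \<in> Poly_Mapping.keys f. (\<lambda>i. Poly_Mapping.lookup m (l, i)) = b}.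
         Poly_Mapping.lookup f m *
         (\<Prod>v\<in>Poly_Mapping.keys (init_monomial l m).
            coords xs v ^ Poly_Mapping.lookup (init_monomial l m) v)) *
      (\<Prod>i\<in>UNIV. p $ i ^ b i))"
proof -
  let ?c = "\<lambda>m. Poly_Mapping.lookup f m * (\<Prod>v\<in>Poly_Mapping.keys (init_monomial l m).
    coords xs v ^ Poly_Mapping.lookup (init_monomial l m) v)"
  let ?b = "\<lambda>m i. Poly_Mapping.lookup m (l, i)"
  have "?b ` Poly_Mapping.keys f \<subseteq> UNIV \<rightarrow>\<^sub>E {..t}"
  proof
    fix b assume "b \<in> ?b ` Poly_Mapping.keys f"
    then obtain m where m: "m \<in> Poly_Mapping.keys f" "b = ?b m" by blast
    then have "b i \<le> t" for i
      using lookup_le_monomial_degree[of m "(l, i)"] assms(2)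
      unfolding mpoly_degree_le_def by (meson order.trans)
    then show "b \<in> UNIV \<rightarrow>\<^sub>E {..t}" by (simp add: PiE_iff)
  qed
  \<comment> \<open>The monomials of \<open>f\<close> are grouped by their exponent vector in the
    last point.\<close>
  then have "(\<Sum>m\<in>Poly_Mapping.keys f. ?c m * (\<Prod>i\<in>UNIV. p $ i ^ ?b m i)) =
      (\<Sum>b\<in>UNIV \<rightarrow>\<^sub>E {..t}. \<Sum>m\<in>{m \<in> Poly_Mapping.keys f. ?b m = b}.
        ?c m * (\<Prod>i\<in>UNIV. p $ i ^ ?b m i))"
    by (intro sum.group[symmetric]) (auto intro: finite_PiE)
  also have "\<dots> = (\<Sum>b\<in>UNIV \<rightarrow>\<^sub>E {..t}.
      (\<Sum>m\<in>{m \<in> Poly_Mapping.keys f. ?b m = b}. ?c m) * (\<Prod>i\<in>UNIV. p $ i ^ b i))"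
    by (intro sum.cong[OF refl]) (auto simp: sum_distrib_right intro!: sum.cong)
  finally show ?thesis
    using mpoly_eval_snoc[OF assms(1,3)] by simp
qed

section \<open>Semi-algebraic relations with a fixed last point, and their traces\<close>

text \<open>Substituting \<open>s\<close> keeps the number of polynomials, the degree bound and
  \<open>\<Phi>\<close>, so the complexity stays \<open>t\<close> while the arity drops by
  one.\<close>

lemma semialg_relation_fix_last:
  fixes P :: "(real ^ 'd::finite) list"
  assumes E: "semialg_relation (Suc l) t P E" and Q: "subseq (Q @ [s]) P"
  shows "semialg_relation l t Q {xs \<in> ktuples Q l. xs @ [s] \<in> E}"
proof -
  from E obtain fs \<Phi> where fs: "length fs = t"
      "\<And>f. f \<in> set fs \<Longrightarrow> mpoly_vars f \<subseteq> {..<Suc l} \<times> UNIV \<and> mpoly_degree_le f t"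
      "\<And>xs. xs \<in> ktuples P (Suc l) \<Longrightarrow> xs \<in> E \<longleftrightarrow> xs \<in> semialg_set (Suc l) fs \<Phi>"
    unfolding semialg_relation_def by blast
  have "\<exists>f'. mpoly_vars f' \<subseteq> {..<l} \<times> UNIV \<and> mpoly_degree_le f' t \<and>
      (\<forall>xs. length xs = l \<longrightarrow> mpoly_eval f' (coords xs) = mpoly_eval f (coords (xs @ [s])))"
    if "f \<in> set fs" for f
    using fs(2)[OF that] mpoly_substitute_last[of f l t s] by metis
  then obtain r where r: "\<And>f. f \<in> set fs \<Longrightarrow> mpoly_vars (r f) \<subseteq> {..<l} \<times> UNIV \<and>
      mpoly_degree_le (r f) t \<and> (\<forall>xs. length xs = l \<longrightarrow>
        mpoly_eval (r f) (coords xs) = mpoly_eval f (coords (xs @ [s])))"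
    by metis
  have "xs @ [s] \<in> E \<longleftrightarrow> xs \<in> semialg_set l (map r fs) \<Phi>" if xs: "xs \<in> ktuples Q l" for xs
  proof -
    have len: "length xs = l" and "subseq (xs @ [s]) (Q @ [s])"
      using xs by (simp_all add: ktuples_def)
    then have "xs @ [s] \<in> ktuples P (Suc l)"
      using Q subseq_order.order_trans[of "xs @ [s]" "Q @ [s]" P] by (simp add: ktuples_def)
    then have "xs @ [s] \<in> E \<longleftrightarrow> \<Phi> (map (\<lambda>f. mpoly_eval f (coords (xs @ [s])) \<ge> 0) fs)"
      using fs(3) len by (simp add: semialg_set_def)
    also have "map (\<lambda>f. mpoly_eval f (coords (xs @ [s])) \<ge> 0) fs =
        map (\<lambda>f. mpoly_eval f (coords xs) \<ge> 0) (map r fs)"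
      using r len by auto
    finally show ?thesis
      using len by (simp add: semialg_set_def)
  qed
  then show ?thesis
    unfolding semialg_relation_def using fs(1) r
    by (intro conjI exI[of _ "map r fs"] exI[of _ \<Phi>]) auto
qed

lemma finite_ktuples: "finite (ktuples P k)"
  by (rule finite_subset[of _ "set (subseqs P)"]) (auto simp: ktuples_def)

lemma card_ktuples_le: "card (ktuples P k) \<le> length P ^ k"
proof -
  have "card (ktuples P k) \<le> card {xs. set xs \<subseteq> set P \<and> length xs = k}"
    by (intro card_mono finite_lists_length_eq) (auto simp: ktuples_def dest: subseq_set_subset)
  also have "\<dots> = card (set P) ^ k"
    by (simp add: card_lists_length_eq)
  also have "\<dots> \<le> length P ^ k"
    by (intro power_mono card_length) simp
  finally show ?thesis .
qed

text \<open>The trace of \<open>p\<close> is determined by the signs at \<open>p\<close> of the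
  polynomials obtained by inserting each \<open>xs\<close> into each \<open>f\<close>. There are at
  most \<open>card X * length fs\<close> of them, all in one space of bounded dimension.\<close>

lemma card_semialg_traces_le:
  fixes X :: "(real ^ 'd::finite) list set"
  assumes "finite X" and X: "\<And>xs. xs \<in> X \<Longrightarrow> length xs = l"
    and fs: "\<And>f. f \<in> set fs \<Longrightarrow> mpoly_vars f \<subseteq> {..<Suc l} \<times> UNIV \<and> mpoly_degree_le f t"
  shows "card (range (\<lambda>p. {xs \<in> X. xs @ [p] \<in> semialg_set (Suc l) fs \<Phi>}))
    \<le> (card X * length fs + 1) ^ ((t + 1) ^ CARD('d))"
proof -
  define I where "I = X \<times> set fs"
  define g where "g = (\<lambda>(xs, f) p. mpoly_eval f (coords (xs @ [p :: real ^ 'd])))"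
  define signs where "signs p = {i \<in> I. g i p \<ge> 0}" for p
  have "finite I"
    using assms(1) by (simp add: I_def)
  have "\<exists>a. \<forall>i\<in>I. \<forall>p. g i p = (\<Sum>b\<in>UNIV \<rightarrow>\<^sub>E {..t}. a i b * (\<Prod>j\<in>UNIV. p $ j ^ b j))"
  proof (rule bchoice, rule ballI)
    show "\<exists>c. \<forall>p. g i p = (\<Sum>b\<in>UNIV \<rightarrow>\<^sub>E {..t}. c b * (\<Prod>j\<in>UNIV. p $ j ^ b j))"
      if iI: "i \<in> I" for i
    proof -
      obtain xs f where i: "i = (xs, f)" "xs \<in> X" "f \<in> set fs"
        using iI by (auto simp: I_def)
      show ?thesis
        unfolding g_def i(1) prod.case using fs[OF i(3)]
        by (intro exI allI) (rule mpoly_eval_snoc_expand[OF _ _ X[OF i(2)]]; simp)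
    qed
  qed
  then obtain a where "\<And>i p. i \<in> I \<Longrightarrow>
      g i p = (\<Sum>b\<in>UNIV \<rightarrow>\<^sub>E {..t}. a i b * (\<Prod>j\<in>UNIV. p $ j ^ b j))"
    by blast
  then have "card (range signs) \<le> (card I + 1) ^ card ((UNIV :: 'd set) \<rightarrow>\<^sub>E {..t})"
    unfolding signs_def by (intro card_sign_patterns_le \<open>finite I\<close>) (auto intro: finite_PiE)
  also have "card ((UNIV :: 'd set) \<rightarrow>\<^sub>E {..t}) = (t + 1) ^ CARD('d)"
    by (simp add: card_PiE)
  also have "(card I + 1) ^ ((t + 1) ^ CARD('d)) \<le> (card X * length fs + 1) ^ ((t + 1) ^ CARD('d))"
    by (intro power_mono) (simp_all add: I_def card_cartesian_product card_length)
  finally have *: "card (range signs) \<le> (card X * length fs + 1) ^ ((t + 1) ^ CARD('d))" .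
  \<comment> \<open>\<open>h\<close> reads the trace off a sign pattern, so there are no more traces
    than patterns.\<close>
  define h where "h Z = {xs \<in> X. \<Phi> (map (\<lambda>f. (xs, f) \<in> Z) fs)}" for Z
  have "{xs \<in> X. xs @ [p] \<in> semialg_set (Suc l) fs \<Phi>} = h (signs p)" for p
  proof -
    have "xs @ [p] \<in> semialg_set (Suc l) fs \<Phi> \<longleftrightarrow> \<Phi> (map (\<lambda>f. (xs, f) \<in> signs p) fs)"
      if "xs \<in> X" for xs
    proof -
      have "map (\<lambda>f. mpoly_eval f (coords (xs @ [p])) \<ge> 0) fs = map (\<lambda>f. (xs, f) \<in> signs p) fs"
        using that by (auto simp: signs_def I_def g_def)
      then show ?thesis
        using X[OF that] by (simp add: semialg_set_def del: map_eq_conv)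
    qed
    then show ?thesis
      unfolding h_def by blast
  qed
  then have "range (\<lambda>p. {xs \<in> X. xs @ [p] \<in> semialg_set (Suc l) fs \<Phi>}) = h ` range signs"
    by (simp add: image_image)
  moreover have "finite (range signs)"
    using \<open>finite I\<close> by (rule finite_subset[rotated, OF iffD2[OF finite_Pow_iff]]) (auto simp: signs_def)
  ultimately show ?thesis
    using card_image_le[of "range signs" h] * by simp
qed

section \<open>Greedy selection of an end-uniform sequence\<close>

text \<open>The chosen points are \<open>Q\<close>, the surviving candidates \<open>S\<close>.\<close>

definition end_uniform :: "nat \<Rightarrow> 'a list set \<Rightarrow> 'a list \<Rightarrow> 'a list \<Rightarrow> bool" where
  "end_uniform l E Q S \<longleftrightarrow>
     (\<forall>xs\<in>ktuples Q l. \<forall>p p'. subseq (xs @ [p]) (Q @ S) \<longrightarrow> subseq (xs @ [p']) (Q @ S) \<longrightarrow>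
        (xs @ [p] \<in> E \<longleftrightarrow> xs @ [p'] \<in> E))"

lemma subseq_snocD:
  assumes "subseq xs (ys @ [q])"
  shows "subseq xs ys \<or> (\<exists>zs. xs = zs @ [q] \<and> subseq zs ys)"
proof -
  from assms obtain as bs where xs: "xs = as @ bs" "subseq as ys" "subseq bs [q]"
    by (auto simp: subseq_append_iff)
  from xs(3) have "bs = [] \<or> bs = [q]"
    by (cases bs) (auto simp: list_emb_Nil2 split: if_splits)
  with xs show ?thesis by auto
qed

text \<open>The part embedded in \<open>ys\<close> stops before \<open>q\<close>, so
  \<open>[q, p]\<close> embeds in \<open>q # zs\<close>. Thus an end that follows the newly chosen
  \<open>q\<close> is a surviving candidate.\<close>

lemma subseq_after:
  assumes sub: "subseq (xs @ [q, p]) (ys @ q # zs)" and q: "q \<notin> set ys"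
  shows "p \<in> set zs"
proof -
  from sub obtain as bs where ab: "xs @ [q, p] = as @ bs" "subseq as ys" "subseq bs (q # zs)"
    by (auto simp: subseq_append_iff)
  have "q \<notin> set as"
    using subseq_set_subset[OF ab(2)] q by auto
  with ab(1) obtain us where "bs = us @ [q, p]"
    by (auto simp: append_eq_append_conv2 Cons_eq_append_conv)
  then have "subseq [q, p] (q # zs)"
    using ab(3) subseq_drop_many[of "[q, p]" "[q, p]" us] subseq_order.order_trans by blast
  then show ?thesis
    by (simp add: subseq_singleton_left)
qed

text \<open>Pigeonhole principle for lists, stated as a product to avoid rounding.\<close>

lemma large_fibre:
  assumes "distinct xs" and "card (f ` set xs) \<le> B"
  obtains y where "length xs \<le> length (filter (\<lambda>x. f x = y) xs) * B"
proof (cases "xs = []")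
  case False
  then obtain y where y: "card (set xs) \<le> card (f -` {y} \<inter> set xs) * card (f ` set xs)"
    using pigeonhole_card[of f "set xs" "f ` set xs"] by auto
  have "f -` {y} \<inter> set xs = set (filter (\<lambda>x. f x = y) xs)"
    by auto
  then have "card (f -` {y} \<inter> set xs) = length (filter (\<lambda>x. f x = y) xs)"
    using assms(1) by (simp only: distinct_card distinct_filter)
  then have "length xs \<le> length (filter (\<lambda>x. f x = y) xs) * card (f ` set xs)"
    using y assms(1) by (simp add: distinct_card)
  also have "\<dots> \<le> length (filter (\<lambda>x. f x = y) xs) * B"
    using assms(2) by (rule mult_le_mono2)
  finally show ?thesis by (rule that)
qed (use that in auto)

lemma end_uniform_subseq:
  "end_uniform l E Q S \<Longrightarrow> subseq S' S \<Longrightarrow> end_uniform l E Q S'"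
  unfolding end_uniform_def by (meson subseq_append' subseq_order.order_trans)

text \<open>A tuple avoiding \<open>q\<close> is covered by the old uniformity, in which
  \<open>q\<close> was itself a candidate. A tuple ending in \<open>q\<close> has its possible ends
  in \<open>S'\<close>, where all traces agree.\<close>

lemma end_uniform_snoc:
  assumes uni: "end_uniform l E Q (q # S)" and dist: "distinct (Q @ q # S)"
    and S': "subseq S' S"
    and trace: "\<And>p p'. p \<in> set S' \<Longrightarrow> p' \<in> set S' \<Longrightarrow>
      {xs \<in> ktuples (Q @ [q]) l. xs @ [p] \<in> E} = {xs \<in> ktuples (Q @ [q]) l. xs @ [p'] \<in> E}"
  shows "end_uniform l E (Q @ [q]) S'"
  unfolding end_uniform_def
proof (intro ballI allI impI)
  fix xs p p'
  assume xs: "xs \<in> ktuples (Q @ [q]) l"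
    and p: "subseq (xs @ [p]) ((Q @ [q]) @ S')" and p': "subseq (xs @ [p']) ((Q @ [q]) @ S')"
  from xs have len: "length xs = l" and sub: "subseq xs (Q @ [q])"
    by (simp_all add: ktuples_def)
  show "xs @ [p] \<in> E \<longleftrightarrow> xs @ [p'] \<in> E"
    using subseq_snocD[OF sub]
  proof
    assume "subseq xs Q"
    then have "xs \<in> ktuples Q l" using len by (simp add: ktuples_def)
    moreover have "subseq ((Q @ [q]) @ S') (Q @ q # S)"
      using S' by (simp add: subseq_append')
    ultimately show ?thesis
      using uni p p' unfolding end_uniform_def by (meson subseq_order.order_trans)
  next
    assume "\<exists>zs. xs = zs @ [q] \<and> subseq zs Q"
    then obtain zs where "xs = zs @ [q]" by blast
    then have "p \<in> set S'" "p' \<in> set S'"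
      using p p' dist by (auto intro: subseq_after)
    then show ?thesis
      using trace xs by blast
  qed
qed

text \<open>With \<open>j\<close> rounds left, each round moves the first candidate to
  \<open>Q\<close> and keeps the largest trace class, at least a fraction \<open>1 / B\<close> of
  the rest. The factor 2 in \<open>2 * B\<close> absorbs the candidate that was moved.\<close>

lemma end_uniform_greedy:
  assumes "B > 0"
    and traces: "\<And>Q. length Q \<le> M \<Longrightarrow>
      card (range (\<lambda>p. {xs \<in> ktuples Q l. xs @ [p] \<in> E})) \<le> B"
    and "distinct (Q @ S)" and "end_uniform l E Q S"
    and "length Q + j = M" and "(2 * B) ^ j \<le> length S"
  shows "\<exists>Q' s. subseq (Q' @ [s]) (Q @ S) \<and> length Q' = M \<and> end_uniform l E Q' [s]"
  using assms(3-)
proof (induction j arbitrary: Q S)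
  case 0
  then obtain s S' where S: "S = s # S'" by (cases S) auto
  have "end_uniform l E Q [s]"
    using 0(2) by (rule end_uniform_subseq) (simp add: S subseq_singleton_left)
  moreover have "subseq (Q @ [s]) (Q @ S)"
    by (simp add: S subseq_append')
  ultimately show ?case using 0 by auto
next
  case (Suc j)
  have "length S > 0"
    using Suc.prems(4) \<open>B > 0\<close> by (rule_tac less_le_trans) auto
  then obtain q S' where S: "S = q # S'" by (cases S) auto
  let ?tr = "\<lambda>p. {xs \<in> ktuples (Q @ [q]) l. xs @ [p] \<in> E}"
  have "finite (range ?tr)"
    by (rule finite_subset[of _ "Pow (ktuples (Q @ [q]) l)"]) (auto simp: finite_ktuples)
  then have "card (?tr ` set S') \<le> card (range ?tr)"
    by (intro card_mono) auto
  also have "\<dots> \<le> B"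
    using Suc.prems by (intro traces) simp
  finally obtain A where A: "length S' \<le> length (filter (\<lambda>p. ?tr p = A) S') * B"
    using large_fibre[of S' ?tr B] Suc.prems(1) S by auto
  define S'' where "S'' = filter (\<lambda>p. ?tr p = A) S'"
  have "end_uniform l E (Q @ [q]) S''"
    using Suc.prems(2,1) unfolding S
    by (rule end_uniform_snoc) (auto simp: S''_def)
  moreover have "(2 * B) ^ j \<le> length S''"
  \<comment> \<open>With \<open>m = (2 * B) ^ j\<close>, a smaller \<open>S''\<close> would give
    \<open>length S' \<le> m * B - B\<close>, whereas
    \<open>length S' \<ge> 2 * m * B - 1\<close>.\<close>
  proof (rule ccontr)
    assume "\<not> (2 * B) ^ j \<le> length S''"
    then have "Suc (length S'') * B \<le> (2 * B) ^ j * B"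
      by (intro mult_le_mono1) simp
    moreover have "2 * ((2 * B) ^ j * B) \<le> Suc (length S')"
      using Suc.prems(4) by (simp add: S mult_ac)
    moreover have "(2 * B) ^ j * B > 0"
      using \<open>B > 0\<close> by simp
    ultimately show False
      using A \<open>B > 0\<close> by (simp add: S''_def)
  qed
  moreover have "distinct ((Q @ [q]) @ S'')"
    using Suc.prems(1) by (auto simp: S S''_def)
  ultimately obtain Q' s where Q': "subseq (Q' @ [s]) ((Q @ [q]) @ S'')" "length Q' = M"
      "end_uniform l E Q' [s]"
    using Suc.IH[of "Q @ [q]" S''] Suc.prems(3) by auto
  moreover have "subseq ((Q @ [q]) @ S'') (Q @ S)"
    by (simp add: S S''_def subseq_append')
  ultimately show ?case
    using subseq_order.order_trans by blast
qed

section \<open>The recursive Ramsey step\<close>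

lemma hom_number_witness:
  obtains S where "subseq S P" and "homogeneous k E S" and "length S = hom_number k P E"
proof -
  \<comment> \<open>The empty list has at most one tuple, so it is homogeneous and the maximum is
    over a nonempty set.\<close>
  have "ktuples [] k \<subseteq> {[]}"
    by (auto simp: ktuples_def dest: list_emb_length)
  then have "homogeneous k E []"
    unfolding homogeneous_def by blast
  then have "{length S | S. subseq S P \<and> homogeneous k E S} \<noteq> {}" by auto
  from Max_in[OF finite_homogeneous_lengths this] show ?thesis
    using that unfolding hom_number_def by auto
qed

text \<open>The greedy choice yields \<open>M\<close> points \<open>Q\<close> and an end
  \<open>s\<close>. A homogeneous \<open>T\<close> in \<open>Q\<close> for the relation with last
  entry \<open>s\<close> extends to \<open>T @ [s]\<close>, whence \<open>Suc n\<close>. The base of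
  the power is twice the trace bound for at most \<open>M ^ l\<close> tuples and \<open>t\<close>
  polynomials.\<close>

lemma semialg_ramsey_property_step:
  assumes "l > 0" and ramsey: "semialg_ramsey_property TYPE('d::finite) l t n M"
  shows "semialg_ramsey_property TYPE('d) (Suc l) t (Suc n)
    ((2 * (M ^ l * t + 1) ^ ((t + 1) ^ CARD('d))) ^ M)"
  unfolding semialg_ramsey_property_def
proof (intro allI impI, elim conjE)
  let ?B = "(M ^ l * t + 1) ^ ((t + 1) ^ CARD('d))"
  fix P :: "(real ^ 'd) list" and E
  assume P: "distinct P" "length P = (2 * ?B) ^ M" and E: "semialg_relation (Suc l) t P E"
  from E obtain fs \<Phi> where fs: "length fs = t"
      "\<And>f. f \<in> set fs \<Longrightarrow> mpoly_vars f \<subseteq> {..<Suc l} \<times> UNIV \<and> mpoly_degree_le f t"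
      "\<And>xs. xs \<in> ktuples P (Suc l) \<Longrightarrow> xs \<in> E \<longleftrightarrow> xs \<in> semialg_set (Suc l) fs \<Phi>"
    unfolding semialg_relation_def by blast
  \<comment> \<open>Traces are counted over all points of the space, so the greedy argument runs on
    the semi-algebraic set, which agrees with \<open>E\<close> on the tuples of
    \<open>P\<close>.\<close>
  let ?E = "semialg_set (Suc l) fs \<Phi>"
  have "card (range (\<lambda>p. {xs \<in> ktuples Q l. xs @ [p] \<in> ?E})) \<le> ?B"
    if "length Q \<le> M" for Q :: "(real ^ 'd) list"
  proof -
    have "card (range (\<lambda>p. {xs \<in> ktuples Q l. xs @ [p] \<in> ?E})) \<le>
        (card (ktuples Q l) * length fs + 1) ^ ((t + 1) ^ CARD('d))"
      by (rule card_semialg_traces_le[OF finite_ktuples]) (use fs in \<open>auto simp: ktuples_def\<close>)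
    also have "card (ktuples Q l) \<le> M ^ l"
      using card_ktuples_le[of Q l] that by (meson order.trans power_mono zero_le)
    then have "(card (ktuples Q l) * length fs + 1) ^ ((t + 1) ^ CARD('d)) \<le> ?B"
      unfolding fs(1) by (intro power_mono add_mono mult_le_mono1) auto
    finally show ?thesis .
  qed
  \<comment> \<open>As \<open>l > 0\<close>, the empty list has no \<open>l\<close>-tuples.\<close>
  moreover have "end_uniform l ?E [] P"
    using \<open>l > 0\<close> by (auto simp: end_uniform_def ktuples_def)
  ultimately obtain Q s where Q: "subseq (Q @ [s]) P" "length Q = M" "end_uniform l ?E Q [s]"
    using end_uniform_greedy[of ?B M l ?E "[]" P M] P by auto
  have "distinct (Q @ [s])"
    using subseq_distinct_eq_filter[OF Q(1) P(1)] P(1) by (metis distinct_filter)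
  then have "hom_number l Q {xs \<in> ktuples Q l. xs @ [s] \<in> E} \<ge> n"
    using ramsey semialg_relation_fix_last[OF E Q(1)] Q(2)
    unfolding semialg_ramsey_property_def by auto
  moreover obtain T where "subseq T Q" "homogeneous l {xs \<in> ktuples Q l. xs @ [s] \<in> E} T"
      "length T = hom_number l Q {xs \<in> ktuples Q l. xs @ [s] \<in> E}"
    by (rule hom_number_witness)
  ultimately have T: "subseq T Q" "homogeneous l {xs \<in> ktuples Q l. xs @ [s] \<in> E} T"
      "length T \<ge> n"
    by simp_all
  have TQ: "subseq (T @ [s]) (Q @ [s])"
    using T(1) by simp
  \<comment> \<open>By end-uniformity, the last entry of any tuple of \<open>T @ [s]\<close> may be
    replaced by \<open>s\<close>, even when it lies in \<open>T\<close>.\<close>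
  have init: "butlast ys \<in> ktuples T l \<and> (ys \<in> E \<longleftrightarrow> butlast ys @ [s] \<in> E)"
    if ys: "ys \<in> ktuples (T @ [s]) (Suc l)" for ys
  proof -
    from ys obtain xs p where ys_eq: "ys = xs @ [p]" and len: "length xs = l"
      by (cases ys rule: rev_cases) (auto simp: ktuples_def)
    have sub: "subseq (xs @ [p]) (T @ [s])"
      using ys by (simp add: ktuples_def ys_eq)
    have xsT: "subseq xs T"
      using subseq_snocD[OF sub] subseq_order.order_trans[of xs "xs @ [p]" T]
      by (auto intro: subseq_rev_drop_many)
    have p: "subseq (xs @ [p]) (Q @ [s])"
      using sub TQ subseq_order.order_trans by blast
    have xsQ: "subseq xs Q"
      using xsT T(1) subseq_order.order_trans by blast
    then have s: "subseq (xs @ [s]) (Q @ [s])"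
      by simp
    have "xs @ [p] \<in> ktuples P (Suc l)" "xs @ [s] \<in> ktuples P (Suc l)"
      using subseq_order.order_trans[OF p Q(1)] subseq_order.order_trans[OF s Q(1)] len
      by (simp_all add: ktuples_def)
    moreover have "xs @ [p] \<in> ?E \<longleftrightarrow> xs @ [s] \<in> ?E"
      using Q(3) p s xsQ len unfolding end_uniform_def ktuples_def by blast
    ultimately show ?thesis
      using fs(3) xsT len by (simp add: ys_eq ktuples_def)
  qed
  have "ktuples T l \<subseteq> ktuples Q l"
    using subseq_order.order_trans[OF _ T(1)] by (auto simp: ktuples_def)
  then have "homogeneous (Suc l) E (T @ [s])"
    using T(2) init unfolding homogeneous_def by blast
  moreover have "subseq (T @ [s]) P"
    using TQ Q(1) by (rule subseq_order.order_trans)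
  ultimately have "length (T @ [s]) \<le> hom_number (Suc l) P E"
    unfolding hom_number_def by (intro Max_ge finite_homogeneous_lengths) blast
  then show "Suc n \<le> hom_number (Suc l) P E"
    using T(3) by simp
qed

text \<open>The empty relation on \<open>N\<close> distinct points of the diagonal is a legitimate
  instance, and no subsequence is longer than \<open>N\<close>. This keeps \<open>M\<close> away
  from 0 and 1 in the final estimate.\<close>

lemma semialg_ramsey_property_imp_le:
  assumes "semialg_ramsey_property TYPE('d::finite) k t n N"
  shows "n \<le> N"
proof -
  define P :: "(real ^ 'd) list" where "P = map (\<lambda>i. \<chi> j. real i) [0..<N]"
  have P: "distinct P" "length P = N"
    by (auto simp: P_def distinct_map inj_on_def vec_eq_iff)
  have "semialg_relation k t P {}"
    unfolding semialg_relation_def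
    by (intro conjI exI[of _ "replicate t 0"] exI[of _ "\<lambda>_. False"])
      (auto simp: mpoly_vars_def mpoly_degree_le_def semialg_set_def)
  then have "n \<le> hom_number k P {}"
    using assms P unfolding semialg_ramsey_property_def by blast
  then show ?thesis
    using P(2) by (metis hom_number_witness list_emb_length order.trans)
qed

section \<open>The final estimate\<close>

theorem theorem8:
  fixes k t :: nat
  assumes "k \<ge> 3" and "t \<ge> 1"
  shows "\<exists>C\<^sub>1 :: real. \<forall>n \<ge> 3.
           let M = semialg_ramsey TYPE('d::finite) (k - 1) t (n - 1)
           in real (semialg_ramsey TYPE('d) k t n) \<le> 2 powr (C\<^sub>1 * real M * log 2 (real M))"
proof -
  define l where "l = k - 1"
  define D where "D = (t + 1) ^ CARD('d)"
  \<comment> \<open>Since \<open>M \<ge> 2\<close>, one factor \<open>M\<close> absorbs the 2 and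
    \<open>M ^ t\<close> absorbs \<open>t + 1\<close>, so
    \<open>2 * (M ^ l * t + 1) ^ D \<le> M ^ c\<close>. The exponent \<open>c\<close> does not
    depend on \<open>n\<close>.\<close>
  define c where "c = Suc ((l + t) * D)"
  have k: "k = Suc l" "l > 0"
    using assms(1) by (auto simp: l_def)
  have "real (semialg_ramsey TYPE('d) k t n) \<le> 2 powr (real c * real M * log 2 (real M))"
    if n: "n \<ge> 3" and M_def: "M = semialg_ramsey TYPE('d) (k - 1) t (n - 1)" for n M
  proof -
    have M: "semialg_ramsey_property TYPE('d) l t (n - 1) M"
      unfolding M_def semialg_ramsey_def l_def
      using semialg_ramsey_property_ex by (rule LeastI_ex)
    have "M \<ge> 2"
      using semialg_ramsey_property_imp_le[OF M] n by simp
    have "semialg_ramsey_property TYPE('d) k t n ((2 * (M ^ l * t + 1) ^ D) ^ M)"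
      using semialg_ramsey_property_step[OF k(2) M] n by (simp add: k(1) D_def)
    then have "semialg_ramsey TYPE('d) k t n \<le> (2 * (M ^ l * t + 1) ^ D) ^ M"
      unfolding semialg_ramsey_def by (rule Least_le)
    also have "\<dots> \<le> (M ^ c) ^ M"
    proof (rule power_mono)
      have "M ^ l * t + 1 \<le> M ^ l * (t + 1)"
        using \<open>M \<ge> 2\<close> by simp
      also have "t + 1 \<le> M ^ t"
        using \<open>M \<ge> 2\<close> less_exp[of t] power_mono[of 2 M t] by linarith
      finally have "M ^ l * t + 1 \<le> M ^ (l + t)"
        by (simp add: power_add)
      then have "(M ^ l * t + 1) ^ D \<le> M ^ ((l + t) * D)"
        unfolding power_mult by (rule power_mono) simp
      then show "2 * (M ^ l * t + 1) ^ D \<le> M ^ c"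
        unfolding c_def power_Suc using \<open>M \<ge> 2\<close> by (intro mult_le_mono)
    qed simp
    finally have "real (semialg_ramsey TYPE('d) k t n) \<le> real M ^ (c * M)"
      by (metis of_nat_le_iff of_nat_power power_mult)
    \<comment> \<open>Writing \<open>M\<close> as \<open>2 powr log 2 M\<close> produces the factor
      \<open>M * log 2 M\<close> in the exponent.\<close>
    also have "\<dots> = 2 powr (log 2 (real M) * real (c * M))"
      using \<open>M \<ge> 2\<close> by (simp add: powr_powr[symmetric] powr_realpow power_mult)
    finally show ?thesis
      by (simp add: mult_ac)
  qed
  then show ?thesis
    unfolding Let_def by blast
qed

end
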